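(* Let $T$ be a Catalan tableau of index $n\ge1$ with profile $u=\pi(T)$, a word of length $n-1$ in the letters N, E, and let $v$ be the canopy of the binary tree $B=\phi(T)$, a word of length $n-1$ in the letters $a,b$, where $\phi$ is the map from Catalan tableaux to binary trees defined by the algorithm described in the context. Then the two words $u$ and $v$ are equal after identifying the letter $a$ with N and the letter $b$ with E.
   Context: **Catalan tableaux.** A Ferrers diagram $F_\lambda$ of a partition $\lambda=(\lambda_1\ge\lambda_2\ge\cdots\ge\lambda_k\ge 0)$ is drawn right-justified with rows written from bottom to top: the $i$-th row from the bottom has $\lambda_i$ cells (zero rows are allowed). It is placed inside a $k\times(n-k)$ rectangle ($k$ rows, $n-k$ columns), in the bottom-right corner. A Catalan tableau of index $n$ consists of some $k$ with $0\le k\le n$, a diagram $F_\lambda$ contained in the $k\times(n-k)$ rectangle, and a filling of the cells of $F_\lambda$ with $0$'s and $1$'s such that (i) each of the $n-k$ columns of the rectangle contains exactly one $1$; (ii) there is no $0$ which has both a $1$ below it in the same column and a $1$ to its right in the same row. The North-West border of the tableau, read from the South-West corner to the North-East corner of the rectangle, is a word of $n$ unit steps N (north) and E (east). For $n\ge1$ its first step is N, because every column is non-empty. **Profile.** The profile $\pi(T)$ is the word of length $n-1$ obtained from the North-West border by deleting its first step (always N). **Binary trees.** A binary tree is either empty or a triple $(L,r,R)$ with root $r$ and left and right subtrees $L,R$, which are binary trees. The left (right) son of a vertex is the root of its left (right) subtree, if non-empty. The right branch of a binary tree is the sequence of vertices obtained from the root by repeatedly passing to the right son. A right chain is a binary tree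 all of whose vertices lie on its right branch. The symmetric order (inorder) on the vertices is defined recursively: first the left subtree, then the root, then the right subtree. **Canopy.** The canopy of a binary tree with $n$ vertices is the word $u_1\cdots u_{n-1}$ in the letters $a,b$ such that $u_i=a$ if the $i$-th vertex in symmetric order has a right son, and $u_i=b$ otherwise. **Algorithm defining $\phi$.** Let $T$ be a Catalan tableau of index $n\ge 1$ and let $\omega$ be its North-West border (a word of length $n$ in N, E). (a) If $\omega$ contains no E, then $\phi(T)$ is the right chain with $n$ vertices. (b) Otherwise write $\omega=\mathrm{N}^m v$ with $v$ beginning with E. Start with the current tableau $T$, with $B$ the right chain with vertices $s_0,s_1,\dots,s_m$ ($s_0$ the root, $s_{i+1}$ the right son of $s_i$), and with the word $v$ (the tail) attached at the vertex $s_m$. In general one has a current tableau, a binary tree $B$ with right branch $s_0,s_1,s_2,\dots$, and a tail $v$ (a word in N, E which is empty or begins with E) attached at a vertex $s_r$ of the right branch; the North-West border of the current tableau is the word $\mathrm{N}^r v$. While $v$ is non-empty, consider the corner cell $c$, the top cell of the leftmost column of the current tableau, and do the following. (c) If $c$ contains $0$: delete the row containing $c$ from the current tableau, keep $B$ and the word $v$, and attach $v$ at $s_{r-1}$ instead of $s_r$. (d) If $c$ contains $1$: delete the column containing $c$ from the current tableau. Write $v=\mathrm{E}\,\mathrm{N}^q\,v'$ with $q\ge 0$ and $v'$ empty or beginning with E. Replace in $B$ the subtree $B_{s_r}$ rooted at $s_r$ by the binary tree with new root $t_1$, left subtree $B_{s_r}$, and right subtree the right chain with $q$ new vertices $t_2,\dots,t_{q+1}$.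 The new tail is $v'$, attached at $t_{q+1}$, the last vertex of the right branch of the new tree; relabel the right branch as $s_0,s_1,\dots$. (e) When the tail is empty, $B$ has $n+1$ vertices and its root has an empty left subtree; $\phi(T)$ is the binary tree obtained from $B$ by deleting the root and the right edge starting from it, i.e. the right subtree of the root of $B$. *)

theory Defs
  imports Main "HOL-Library.Tree" "HOL-Library.While_Combinator"
begin

section \<open>Catalan tableaux\<close>

text \<open>
  A filling of a right-justified Ferrers diagram inside a rectangle. \<open>rows T\<close> lists the rows of
  the rectangle from bottom to top (zero rows are empty lists), so the partition is
  \<open>map length (rows T)\<close>. Since the diagram is right-justified, columns are numbered from the
  right, starting at 0, and each row lists its cells from right to left; hence smaller column
  indices lie further to the right. The number of columns of the rectangle is \<open>width T\<close>.
  The entry \<open>True\<close> stands for 1 and \<open>False\<close> for 0.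
\<close>

record tableau =
  width :: nat
  rows :: "bool list list"

definition is_cell :: "tableau \<Rightarrow> nat \<Rightarrow> nat \<Rightarrow> bool" where
  "is_cell T i j \<longleftrightarrow> i < length (rows T) \<and> j < length (rows T ! i)"

definition has_one :: "tableau \<Rightarrow> nat \<Rightarrow> nat \<Rightarrow> bool" where
  "has_one T i j \<longleftrightarrow> is_cell T i j \<and> rows T ! i ! j"

definition has_zero :: "tableau \<Rightarrow> nat \<Rightarrow> nat \<Rightarrow> bool" where
  "has_zero T i j \<longleftrightarrow> is_cell T i j \<and> \<not> rows T ! i ! j"

definition index :: "tableau \<Rightarrow> nat" where
  "index T = length (rows T) + width T"

definition catalan_tableau :: "tableau \<Rightarrow> bool" where
  "catalan_tableau T \<longleftrightarrow>
     sorted_wrt (\<ge>) (map length (rows T)) \<and>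
     (\<forall>xs \<in> set (rows T). length xs \<le> width T) \<and>
     (\<forall>j < width T. \<exists>!i. has_one T i j) \<and>
     \<not> (\<exists>i j. has_zero T i j \<and> (\<exists>i'<i. has_one T i' j) \<and> (\<exists>j'<j. has_one T i j'))"

datatype direction = North | East

text \<open>
  The border of the diagram with the given row lengths (bottom to top), read from the point at
  distance \<open>x\<close> from the right side of the rectangle at the foot of the first listed row: go east
  to the left end of that row, climb along it, and continue.
\<close>

fun border_from :: "nat \<Rightarrow> nat list \<Rightarrow> direction list" where
  "border_from x [] = replicate x East"
| "border_from x (l # ls) = replicate (x - l) East @ North # border_from l ls"

definition border :: "tableau \<Rightarrow> direction list" where
  "border T = border_from (width T) (map length (rows T))"

definition profile :: "tableau \<Rightarrow> direction list" where
  "profile T = tl (border T)"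


section \<open>Binary trees and canopy\<close>

text \<open>Only the shape of a binary tree matters, so vertices carry the label \<open>()\<close>.\<close>

type_synonym bintree = "unit tree"

fun right_chain :: "nat \<Rightarrow> bintree" where
  "right_chain 0 = Leaf"
| "right_chain (Suc n) = Node Leaf () (right_chain n)"

text \<open>The vertices in symmetric order, each given as the subtree rooted at it.\<close>

fun vertices :: "bintree \<Rightarrow> bintree list" where
  "vertices Leaf = []"
| "vertices (Node l x r) = vertices l @ Node l x r # vertices r"

datatype letter = letter_a | letter_b

definition canopy :: "bintree \<Rightarrow> letter list" where
  "canopy B = map (\<lambda>s. if right s \<noteq> Leaf then letter_a else letter_b) (butlast (vertices B))"

fun letter_direction :: "letter \<Rightarrow> direction" where
  "letter_direction letter_a = North"
| "letter_direction letter_b = East"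


section \<open>The map from Catalan tableaux to binary trees\<close>

text \<open>
  The corner cell is the top cell of the leftmost column, which has index \<open>width T - 1\<close>.
\<close>

definition corner_row :: "tableau \<Rightarrow> nat" where
  "corner_row T = Max {i. is_cell T i (width T - 1)}"

definition delete_row :: "nat \<Rightarrow> tableau \<Rightarrow> tableau" where
  "delete_row i T = T\<lparr>rows := take i (rows T) @ drop (Suc i) (rows T)\<rparr>"

definition delete_leftmost_column :: "tableau \<Rightarrow> tableau" where
  "delete_leftmost_column T =
     T\<lparr>width := width T - 1, rows := map (take (width T - 1)) (rows T)\<rparr>"

text \<open>
  \<open>replace_at r f B\<close> replaces the subtree of \<open>B\<close> rooted at the vertex number \<open>r\<close> of the right
  branch (the root being number 0) by its image under \<open>f\<close>.
\<close>

fun replace_at :: "nat \<Rightarrow> (bintree \<Rightarrow> bintree) \<Rightarrow> bintree \<Rightarrow> bintree" where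
  "replace_at 0 f B = f B"
| "replace_at (Suc r) f (Node L x R) = Node L x (replace_at r f R)"
| "replace_at (Suc r) f Leaf = Leaf"

text \<open>
  A state \<open>(T, B, r, v)\<close> consists of the current tableau, the current tree, the number of the
  vertex of the right branch of \<open>B\<close> at which the tail is attached, and the tail. In the second
  case of a step the new vertices \<open>t\<^sub>1, \<dots>, t\<^sub>q\<^sub>+\<^sub>1\<close> become the vertices number \<open>r, \<dots>, r + q\<close> of
  the right branch.
\<close>

type_synonym state = "tableau \<times> bintree \<times> nat \<times> direction list"

fun phi_step :: "state \<Rightarrow> state" where
  "phi_step (T, B, r, v) =
     (if has_zero T (corner_row T) (width T - 1)
      then (delete_row (corner_row T) T, B, r - 1, v)
      else
        let q = length (takeWhile (\<lambda>d. d = North) (tl v));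
            v' = dropWhile (\<lambda>d. d = North) (tl v)
        in (delete_leftmost_column T,
            replace_at r (\<lambda>S. Node S () (right_chain q)) B,
            r + q,
            v'))"

definition phi_start :: "tableau \<Rightarrow> state" where
  "phi_start T =
     (let m = length (takeWhile (\<lambda>d. d = North) (border T));
          v = dropWhile (\<lambda>d. d = North) (border T)
      in (T, right_chain (m + 1), m, v))"

text \<open>
  On a Catalan tableau every step lowers the length of the North-West border of the current
  tableau by one, so the loop terminates; elsewhere \<open>phi\<close> need not be meaningful.
\<close>

definition phi :: "tableau \<Rightarrow> bintree" where
  "phi T =
     (if East \<notin> set (border T) then right_chain (index T)
      else case while (\<lambda>(T, B, r, v). v \<noteq> []) phi_step (phi_start T) of
             (T, B, r, v) \<Rightarrow> right B)"

end

theory Submission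
  imports Defs
begin

text \<open>
  The loop computing \<open>\<phi>(T)\<close> writes the border of \<open>T\<close> into the tree from left to right. Record for
  each vertex of a binary tree, in symmetric order, the letter N if it has a right son and E
  otherwise. A step that inserts \<open>t\<^sub>1, \<dots>, t\<^sub>q\<^sub>+\<^sub>1\<close> hangs the old subtree to the left of
  \<open>t\<^sub>1\<close>, at the end of the right branch. So the new vertices come last in symmetric order, no old
  vertex gains or loses a right son, and the recorded word just grows by \<open>N\<^sup>qE\<close>
  (\<open>right_son_word_replace_at\<close>). The same step removes \<open>E N\<^sup>q\<close> from the front of the tail.
  Since the recorded word always ends with E, the word without its last letter, followed by the
  tail, is an invariant; it starts out as the border of \<open>T\<close>. When the tail has been used
  up, the recorded word without its last letter is the border. Passing to the right subtree
  of the root, whose left subtree is empty, removes the first letter, which turns the border into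
  the profile and leaves the canopy of \<open>\<phi>(T)\<close> on the other side.

  Two things keep this running. The word \<open>N\<^sup>r v\<close>, where the tail \<open>v\<close> is attached at
  \<open>s\<^sub>r\<close>, remains the border of the current tableau; and the current tableau remains Catalan,
  so that its leftmost column is non-empty, whence \<open>r \<ge> 1\<close>, and the root is never touched. A row is
  deleted only when its leftmost cell is a 0 above the 1 of its column; the second Catalan
  condition then makes the whole row zero, so every column keeps its 1.
\<close>


section \<open>Borders\<close>

lemma border_from_full_rows:
  "border_from x (replicate r x @ ls) = replicate r North @ border_from x ls"
  by (induction r) auto

lemma border_from_narrower:
  assumes "x > 0" "\<forall>l \<in> set ls. l < x"
  shows "border_from x ls = East # border_from (x - 1) ls"
proof (cases ls)
  case Nil
  then show ?thesis using assms by (cases x) auto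
next
  case (Cons l ls')
  then have "x - l = Suc (x - 1 - l)" using assms by auto
  with Cons show ?thesis by simp
qed

lemma length_border_from:
  assumes "sorted_wrt (\<ge>) ls" "\<forall>l \<in> set ls. l \<le> x"
  shows "length (border_from x ls) = length ls + x"
  using assms by (induction ls arbitrary: x) auto

lemma length_border:
  assumes "catalan_tableau T"
  shows "length (border T) = index T"
  using assms unfolding border_def index_def catalan_tableau_def
  by (subst length_border_from) auto

lemma sorted_split_maximal:
  fixes x :: nat
  assumes "sorted_wrt (\<ge>) ls" "\<forall>l \<in> set ls. l \<le> x"
  obtains r ls' where "ls = replicate r x @ ls'" "\<forall>l \<in> set ls'. l < x"
  using assms
proof (induction ls arbitrary: thesis)
  case Nil
  then show ?case by (metis append_Nil empty_iff list.set(1) replicate_0)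
next
  case (Cons l ls)
  show ?case
  proof (cases "l = x")
    case True
    obtain r ls' where "ls = replicate r x @ ls'" "\<forall>l \<in> set ls'. l < x"
      using Cons.IH Cons.prems by auto
    with True show ?thesis using Cons.prems(1)[of "Suc r" ls'] by simp
  next
    case False
    then have "\<forall>k \<in> set (l # ls). k < x" using Cons.prems by force
    then show ?thesis using Cons.prems(1)[of 0 "l # ls"] by simp
  qed
qed

definition initial_norths :: "direction list \<Rightarrow> nat" where
  "initial_norths w = length (takeWhile (\<lambda>d. d = North) w)"

definition after_norths :: "direction list \<Rightarrow> direction list" where
  "after_norths w = dropWhile (\<lambda>d. d = North) w"

lemma initial_norths_replicate [simp]:
  "initial_norths (replicate r North @ w) = r + initial_norths w"
  by (induction r) (auto simp: initial_norths_def)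

lemma after_norths_replicate [simp]:
  "after_norths (replicate r North @ w) = after_norths w"
  by (induction r) (auto simp: after_norths_def)

lemma norths_East [simp]:
  "initial_norths (East # w) = 0" "after_norths (East # w) = East # w"
  by (simp_all add: initial_norths_def after_norths_def)

lemma norths_split: "replicate (initial_norths w) North @ after_norths w = w"
  by (induction w) (auto simp: initial_norths_def after_norths_def)

text \<open>
  The geometric meaning of \<open>N\<^sup>r v\<close>: if \<open>v\<close> is non-empty then the \<open>r\<close> bottom rows are exactly those
  that reach the leftmost column.
\<close>

lemma catalan_full_rows:
  assumes T: "catalan_tableau T" and v: "after_norths (border T) \<noteq> []"
  obtains ls where "width T > 0"
    "map length (rows T) = replicate (initial_norths (border T)) (width T) @ ls"
    "\<forall>l \<in> set ls. l < width T"
    "after_norths (border T) = East # border_from (width T - 1) ls"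
proof -
  obtain r ls where ls: "map length (rows T) = replicate r (width T) @ ls"
      "\<forall>l \<in> set ls. l < width T"
    using T sorted_split_maximal[of "map length (rows T)" "width T"]
    unfolding catalan_tableau_def by (metis (mono_tags, lifting) image_iff list.set_map)
  have b: "border T = replicate r North @ border_from (width T) ls"
    unfolding border_def ls(1) by (rule border_from_full_rows)
  have w: "width T > 0"
  proof (rule ccontr)
    assume "\<not> width T > 0"
    then have "ls = []" "border_from (width T) [] = []" using ls(2) by (cases ls; auto)+
    then show False using v b by (simp add: after_norths_def)
  qed
  have e: "border_from (width T) ls = East # border_from (width T - 1) ls"
    by (rule border_from_narrower[OF w ls(2)])
  show thesis
    using that[of ls] w ls b e by simp
qed


section \<open>Deleting a row or a column\<close>

lemma corner_row_eq:
  assumes T: "catalan_tableau T" and v: "after_norths (border T) \<noteq> []"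
  shows "initial_norths (border T) > 0"
    and "corner_row T = initial_norths (border T) - 1"
    and "is_cell T (corner_row T) (width T - 1)"
proof -
  let ?r = "initial_norths (border T)"
  obtain ls where ls: "width T > 0" "map length (rows T) = replicate ?r (width T) @ ls"
      "\<forall>l \<in> set ls. l < width T"
    using catalan_full_rows[OF T v] .
  have len: "length (rows T) = ?r + length ls"
    using arg_cong[OF ls(2), of length] by simp
  have nth: "length (rows T ! i) = (if i < ?r then width T else ls ! (i - ?r))"
    if "i < length (rows T)" for i
    using that arg_cong[OF ls(2), of "\<lambda>xs. xs ! i"] by (simp add: nth_append)
  have cells: "{i. is_cell T i (width T - 1)} = {..<?r}"
  proof -
    have "is_cell T i (width T - 1) \<longleftrightarrow> i < ?r" for i
    proof (cases "i < ?r")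
      case True
      then show ?thesis using ls(1) len nth[of i] by (simp add: is_cell_def)
    next
      case False
      have "ls ! (i - ?r) < width T" if "i < length (rows T)"
        using ls(3) that False len by auto
      then show ?thesis using False nth[of i] by (auto simp: is_cell_def)
    qed
    then show ?thesis by auto
  qed
  obtain i where "has_one T i (width T - 1)"
    using T ls(1) unfolding catalan_tableau_def by (metis diff_less zero_less_one)
  then have "i \<in> {..<?r}" using cells by (auto simp: has_one_def)
  then show r: "?r > 0" by auto
  have "Max {..<?r} = ?r - 1"
    by (rule Max_eqI) (use r in auto)
  then show c: "corner_row T = ?r - 1" unfolding corner_row_def cells .
  have "corner_row T \<in> {i. is_cell T i (width T - 1)}" unfolding cells c using r by simp
  then show "is_cell T (corner_row T) (width T - 1)" by simp
qed

text \<open>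
  Suppose the corner is 0. The 1 of the leftmost column then lies below the corner, so a 1 elsewhere
  in the corner's row would complete the forbidden pattern.
\<close>

lemma zero_corner_row_has_no_one:
  assumes T: "catalan_tableau T" and v: "after_norths (border T) \<noteq> []"
    and z: "has_zero T (corner_row T) (width T - 1)"
  shows "\<not> has_one T (corner_row T) j"
proof
  assume one: "has_one T (corner_row T) j"
  have w: "width T > 0" using catalan_full_rows[OF T v] by blast
  obtain i where i: "has_one T i (width T - 1)"
    using T w unfolding catalan_tableau_def by (metis diff_less zero_less_one)
  have "finite {i. is_cell T i (width T - 1)}"
    by (rule finite_subset[of _ "{..<length (rows T)}"]) (auto simp: is_cell_def)
  then have "i \<le> corner_row T"
    unfolding corner_row_def using i by (intro Max_ge) (auto simp: has_one_def)
  moreover have "i \<noteq> corner_row T" using i z by (auto simp: has_one_def has_zero_def)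
  ultimately have "i < corner_row T" by simp
  moreover have "j < width T - 1"
  proof -
    have "j < length (rows T ! corner_row T)" "rows T ! corner_row T \<in> set (rows T)"
      using one by (auto simp: has_one_def is_cell_def)
    then have "j < width T" using T unfolding catalan_tableau_def by fastforce
    moreover have "j \<noteq> width T - 1" using one z by (auto simp: has_one_def has_zero_def)
    ultimately show ?thesis by simp
  qed
  ultimately show False using T z i one unfolding catalan_tableau_def by blast
qed

lemma rows_delete_row_nth:
  assumes "k < length (rows T)" "i < length (rows T) - 1"
  shows "rows (delete_row k T) ! i = rows T ! (if i < k then i else Suc i)"
  using assms by (auto simp: delete_row_def nth_append min_def)

lemma delete_row_entries:
  assumes k: "k < length (rows T)"
  shows "has_one (delete_row k T) i j \<longleftrightarrow> has_one T (if i < k then i else Suc i) j"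
    and "has_zero (delete_row k T) i j \<longleftrightarrow> has_zero T (if i < k then i else Suc i) j"
proof -
  have "length (rows (delete_row k T)) = length (rows T) - 1"
    using k by (simp add: delete_row_def)
  moreover have "i < length (rows T) - 1 \<longleftrightarrow> (if i < k then i else Suc i) < length (rows T)"
    using k by auto
  ultimately show "has_one (delete_row k T) i j \<longleftrightarrow> has_one T (if i < k then i else Suc i) j"
    and "has_zero (delete_row k T) i j \<longleftrightarrow> has_zero T (if i < k then i else Suc i) j"
    unfolding has_one_def has_zero_def is_cell_def using rows_delete_row_nth[OF k, of i] by auto
qed

lemma catalan_delete_row:
  assumes T: "catalan_tableau T" and k: "k < length (rows T)" and no: "\<And>j. \<not> has_one T k j"
  shows "catalan_tableau (delete_row k T)"
proof -
  let ?s = "\<lambda>i. if i < k then i else Suc i"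
  note e = delete_row_entries[OF k]
  have split: "rows T = take k (rows T) @ rows T ! k # drop (Suc k) (rows T)"
    by (rule id_take_nth_drop[OF k])
  have "sorted_wrt (\<ge>) (map length (take k (rows T) @ rows T ! k # drop (Suc k) (rows T)))"
    using T unfolding catalan_tableau_def split[symmetric] by blast
  then have 1: "sorted_wrt (\<ge>) (map length (rows (delete_row k T)))"
    by (auto simp: delete_row_def sorted_wrt_append)
  have "set (rows (delete_row k T)) \<subseteq> set (rows T)"
    unfolding delete_row_def by (auto dest: in_set_takeD in_set_dropD)
  then have 2: "\<forall>xs \<in> set (rows (delete_row k T)). length xs \<le> width (delete_row k T)"
    using T unfolding catalan_tableau_def by (auto simp: delete_row_def)
  have 3: "\<exists>!i. has_one (delete_row k T) i j" if "j < width (delete_row k T)" for j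
  proof -
    have "j < width T" using that by (simp add: delete_row_def)
    then obtain i where i: "has_one T i j" "\<And>i'. has_one T i' j \<Longrightarrow> i' = i"
      using T unfolding catalan_tableau_def by blast
    have "i \<noteq> k" using i(1) no by blast
    show ?thesis
    proof
      show "has_one (delete_row k T) (if i < k then i else i - 1) j"
        unfolding e using i(1) \<open>i \<noteq> k\<close> by (cases "i < k") auto
    next
      fix i' assume "has_one (delete_row k T) i' j"
      then have "?s i' = i" unfolding e by (rule i(2))
      then show "i' = (if i < k then i else i - 1)" by (auto split: if_splits)
    qed
  qed
  have mono: "?s i' < ?s i" if "i' < i" for i i' using that by auto
  have 4: "\<not> (\<exists>i j. has_zero (delete_row k T) i j \<and> (\<exists>i'<i. has_one (delete_row k T) i' j)
      \<and> (\<exists>j'<j. has_one (delete_row k T) i j'))"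
    using T mono unfolding catalan_tableau_def e by blast
  from 1 2 3 4 show ?thesis unfolding catalan_tableau_def by blast
qed

lemma delete_leftmost_column_entries:
  "has_one (delete_leftmost_column T) i j \<longleftrightarrow> has_one T i j \<and> j < width T - 1"
  "has_zero (delete_leftmost_column T) i j \<longleftrightarrow> has_zero T i j \<and> j < width T - 1"
  by (auto simp: has_one_def has_zero_def is_cell_def delete_leftmost_column_def)

lemma catalan_delete_leftmost_column:
  assumes T: "catalan_tableau T"
  shows "catalan_tableau (delete_leftmost_column T)"
proof -
  note e = delete_leftmost_column_entries
  have "sorted_wrt (\<lambda>xs ys. length xs \<ge> length ys) (rows T)"
    using T by (simp add: catalan_tableau_def sorted_wrt_map)
  then have 1: "sorted_wrt (\<ge>) (map length (rows (delete_leftmost_column T)))"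
    by (auto simp: delete_leftmost_column_def sorted_wrt_map elim: sorted_wrt_mono_rel[rotated])
  have 2: "\<forall>xs \<in> set (rows (delete_leftmost_column T)).
      length xs \<le> width (delete_leftmost_column T)"
    by (auto simp: delete_leftmost_column_def)
  have 3: "\<exists>!i. has_one (delete_leftmost_column T) i j"
    if "j < width (delete_leftmost_column T)" for j
  proof -
    have "j < width T - 1" using that by (simp add: delete_leftmost_column_def)
    moreover from this have "\<exists>!i. has_one T i j" using T unfolding catalan_tableau_def by simp
    ultimately show ?thesis unfolding e by simp
  qed
  show ?thesis using 1 2 3 T unfolding catalan_tableau_def e by blast
qed

lemma border_delete_row:
  assumes T: "catalan_tableau T" and v: "after_norths (border T) \<noteq> []"
  shows "border (delete_row (corner_row T) T)
    = replicate (initial_norths (border T) - 1) North @ after_norths (border T)"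
proof -
  let ?r = "initial_norths (border T)"
  obtain ls where ls: "width T > 0" "map length (rows T) = replicate ?r (width T) @ ls"
      "\<forall>l \<in> set ls. l < width T" "after_norths (border T) = East # border_from (width T - 1) ls"
    using catalan_full_rows[OF T v] .
  note r = corner_row_eq[OF T v]
  have "map length (rows (delete_row (corner_row T) T)) = replicate (?r - 1) (width T) @ ls"
    using r(1) unfolding delete_row_def r(2)
    by (simp add: take_map[symmetric] drop_map[symmetric] ls(2))
  then show ?thesis
    using border_from_full_rows border_from_narrower[OF ls(1,3)] ls(4)
    by (simp add: border_def delete_row_def)
qed

lemma border_delete_leftmost_column:
  assumes T: "catalan_tableau T" and v: "after_norths (border T) \<noteq> []"
  shows "border (delete_leftmost_column T)
    = replicate (initial_norths (border T)) North @ tl (after_norths (border T))"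
proof -
  let ?r = "initial_norths (border T)"
  obtain ls where ls: "width T > 0" "map length (rows T) = replicate ?r (width T) @ ls"
      "\<forall>l \<in> set ls. l < width T" "after_norths (border T) = East # border_from (width T - 1) ls"
    using catalan_full_rows[OF T v] .
  have "map length (rows (delete_leftmost_column T))
      = map (\<lambda>l. min l (width T - 1)) (map length (rows T))"
    by (simp add: delete_leftmost_column_def)
  also have "\<dots> = replicate ?r (width T - 1) @ ls"
    unfolding ls(2) using ls(1,3) by (auto intro!: map_idI)
  finally show ?thesis
    using border_from_full_rows ls(4) by (simp add: border_def delete_leftmost_column_def)
qed


section \<open>The word of right sons\<close>

definition right_son_word :: "bintree \<Rightarrow> direction list" where
  "right_son_word B = map (\<lambda>s. if right s \<noteq> Leaf then North else East) (vertices B)"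

lemma right_son_word_simps [simp]:
  "right_son_word Leaf = []"
  "right_son_word (Node l x r)
    = right_son_word l @ (if r \<noteq> Leaf then North else East) # right_son_word r"
  by (auto simp: right_son_word_def)

lemma canopy_eq_butlast_right_son_word:
  "map letter_direction (canopy B) = butlast (right_son_word B)"
  unfolding canopy_def right_son_word_def map_butlast[symmetric] map_map
  by simp

lemma right_son_word_right_chain:
  "right_son_word (right_chain (Suc q)) = replicate q North @ [East]"
  by (induction q) auto

lemma right_son_word_ends_East:
  "B \<noteq> Leaf \<Longrightarrow> right_son_word B = butlast (right_son_word B) @ [East]"
  by (induction B) (auto simp: butlast_append)

fun right_branch_length :: "bintree \<Rightarrow> nat" where
  "right_branch_length Leaf = 0"
| "right_branch_length (Node l x r) = Suc (right_branch_length r)"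

lemma right_branch_length_right_chain [simp]: "right_branch_length (right_chain q) = q"
  by (induction q) auto

lemma replace_at_Node_nonempty:
  "r < right_branch_length B \<Longrightarrow> replace_at r (\<lambda>S. Node S () C) B \<noteq> Leaf"
  by (cases r; cases B) auto

lemma right_branch_length_replace_at:
  "r < right_branch_length B \<Longrightarrow>
    right_branch_length (replace_at r (\<lambda>S. Node S () (right_chain q)) B) = r + Suc q"
  by (induction r "\<lambda>S. Node S () (right_chain q)" B rule: replace_at.induct) auto

text \<open>
  The replaced subtree is the last stretch of the symmetric order, so the new vertices follow all
  old ones. The parent of the replaced subtree keeps a right son only because that
  subtree is non-empty, that is, because \<open>r\<close> is the number of an actual vertex.
\<close>

lemma right_son_word_replace_at:
  "r < right_branch_length B \<Longrightarrow>
    right_son_word (replace_at r (\<lambda>S. Node S () (right_chain q)) B)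
      = right_son_word B @ replicate q North @ [East]"
proof (induction r "\<lambda>S. Node S () (right_chain q)" B rule: replace_at.induct)
  case (1 B)
  then show ?case using right_son_word_right_chain[of q] by simp
next
  case (2 r L x R)
  then have "R \<noteq> Leaf" by auto
  with 2 show ?case using replace_at_Node_nonempty[of r R "right_chain q"] by simp
qed simp


section \<open>The invariant of the loop\<close>

text \<open>
  The pair \<open>r, v\<close> is determined by the border of the current tableau, so the invariant expresses it
  through that border. That the tail is attached at an actual vertex also makes \<open>B\<close>
  non-empty. The word \<open>w\<close> stands for the border of the initial tableau.
\<close>

fun phi_invariant :: "direction list \<Rightarrow> state \<Rightarrow> bool" where
  "phi_invariant w (T, B, r, v) \<longleftrightarrow>
     catalan_tableau T \<and> r = initial_norths (border T) \<and> v = after_norths (border T) \<and>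
     r < right_branch_length B \<and> left B = Leaf \<and> butlast (right_son_word B) @ v = w"

lemma phi_invariant_start:
  assumes "catalan_tableau T"
  shows "phi_invariant (border T) (phi_start T)"
  using assms norths_split[of "border T"] right_son_word_right_chain[of "initial_norths (border T)"]
  by (simp add: phi_start_def Let_def initial_norths_def after_norths_def butlast_append)

lemma phi_invariant_step:
  assumes inv: "phi_invariant w (T, B, r, v)" and v: "v \<noteq> []"
  shows "phi_invariant w (phi_step (T, B, r, v))"
    and "index (fst (phi_step (T, B, r, v))) < index T"
proof -
  let ?c = "corner_row T"
  have T: "catalan_tableau T" and rv: "r = initial_norths (border T)" "v = after_norths (border T)"
    and B: "r < right_branch_length B" "left B = Leaf" "butlast (right_son_word B) @ v = w"
    using inv by auto
  have vb: "after_norths (border T) \<noteq> []" using v rv by simp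
  note c = corner_row_eq[OF T vb]
  obtain ls where w: "width T > 0" and hd: "v = East # border_from (width T - 1) ls"
    using catalan_full_rows[OF T vb] rv by metis
  have hdE: "v = East # tl v" using hd by simp
  have v_norths: "initial_norths v = 0" "after_norths v = v" using hd by simp_all
  have k: "?c < length (rows T)" using c(3) by (simp add: is_cell_def)
  have "phi_invariant w (phi_step (T, B, r, v)) \<and> index (fst (phi_step (T, B, r, v))) < index T"
  proof (cases "has_zero T ?c (width T - 1)")
    case True
    have "catalan_tableau (delete_row ?c T)"
      using catalan_delete_row[OF T k] zero_corner_row_has_no_one[OF T vb True] by blast
    moreover have "border (delete_row ?c T) = replicate (r - 1) North @ v"
      using border_delete_row[OF T vb] rv by simp
    moreover have "index (delete_row ?c T) < index T"
      using k by (simp add: index_def delete_row_def)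
    ultimately show ?thesis using True B v_norths by simp
  next
    case False
    define q where "q = initial_norths (tl v)"
    define v' where "v' = after_norths (tl v)"
    define B' where "B' = replace_at r (\<lambda>S. Node S () (right_chain q)) B"
    have step: "phi_step (T, B, r, v) = (delete_leftmost_column T, B', r + q, v')"
      using False by (simp add: q_def v'_def B'_def initial_norths_def after_norths_def Let_def)
    have 1: "catalan_tableau (delete_leftmost_column T)"
      by (rule catalan_delete_leftmost_column[OF T])
    have 2: "border (delete_leftmost_column T) = replicate r North @ tl v"
      using border_delete_leftmost_column[OF T vb] rv by simp
    have 3: "r + q < right_branch_length B'"
      unfolding B'_def using right_branch_length_replace_at[OF B(1)] by simp
    have "B \<noteq> Leaf" using B(1) by auto
    \<comment> \<open>If \<open>r\<close> were 0, the root of \<open>B'\<close> would be \<open>t\<^sub>1\<close>, with left subtree \<open>B\<close>.\<close>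
    have 4: "left B' = Leaf"
      using c(1) rv(1) B(2) \<open>B \<noteq> Leaf\<close> unfolding B'_def by (cases r; cases B) auto
    have "butlast (right_son_word B') @ v' = right_son_word B @ replicate q North @ v'"
      unfolding B'_def using right_son_word_replace_at[OF B(1)] by (simp add: butlast_append)
    also have "\<dots> = right_son_word B @ tl v"
      unfolding q_def v'_def by (simp add: norths_split)
    \<comment> \<open>The final E of the old word is now accounted for by the E that opened the tail.\<close>
    also have "\<dots> = butlast (right_son_word B) @ East # tl v"
      by (subst right_son_word_ends_East[OF \<open>B \<noteq> Leaf\<close>]) simp
    also have "\<dots> = w" using B(3) hdE by simp
    finally have 5: "butlast (right_son_word B') @ v' = w" .
    have "index (delete_leftmost_column T) < index T"
      using w by (simp add: index_def delete_leftmost_column_def)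
    then show ?thesis unfolding step using 1 2 3 4 5 by (simp add: q_def v'_def)
  qed
  then show "phi_invariant w (phi_step (T, B, r, v))"
    and "index (fst (phi_step (T, B, r, v))) < index T" by auto
qed

lemma phi_loop_canopy:
  assumes T: "catalan_tableau T"
  shows "case while (\<lambda>(T, B, r, v). v \<noteq> []) phi_step (phi_start T) of
    (T', B, r, v) \<Rightarrow> butlast (right_son_word (right B)) = tl (border T)"
    (is "?Q (while ?b phi_step (phi_start T))")
proof (rule while_rule[where P = "phi_invariant (border T)" and r = "measure (\<lambda>s. index (fst s))"])
  show "phi_invariant (border T) (phi_start T)" by (rule phi_invariant_start[OF T])
next
  fix s assume "phi_invariant (border T) s" "?b s"
  then show "phi_invariant (border T) (phi_step s)"
    using phi_invariant_step(1) by (cases s) blast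
next
  fix s assume "phi_invariant (border T) s" "?b s"
  then show "(phi_step s, s) \<in> measure (\<lambda>s. index (fst s))"
    using phi_invariant_step(2) by (cases s) force
next
  fix s assume inv: "phi_invariant (border T) s" and stop: "\<not> ?b s"
  obtain T' B r v where s: "s = (T', B, r, v)" by (cases s)
  have B: "r < right_branch_length B" "left B = Leaf" "butlast (right_son_word B) = border T"
    using inv stop s by auto
  then obtain x R where "B = Node Leaf x R" by (cases B) auto
  then have "butlast (right_son_word R) = tl (border T)"
    unfolding B(3)[symmetric] by (cases R) auto
  with \<open>B = Node Leaf x R\<close> show "?Q s" by (simp add: s)
qed simp

theorem proposition2p5:
  fixes T :: tableau and n :: nat
  assumes "n \<ge> 1" and "catalan_tableau T" and "index T = n"
  shows "profile T = map letter_direction (canopy (phi T))"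
proof (cases "East \<in> set (border T)")
  case True
  then show ?thesis
    using phi_loop_canopy[OF assms(2)]
    by (auto simp: canopy_eq_butlast_right_son_word phi_def profile_def split: prod.splits)
next
  case False
  then have "\<forall>d \<in> set (border T). d = North" by (metis direction.exhaust)
  then have b: "border T = replicate n North"
    using length_border[OF assms(2)] assms(3) by (metis replicate_eqI)
  obtain m where m: "n = Suc m" using assms(1) by (cases n) auto
  have "phi T = right_chain (Suc m)" using False assms(3) m by (simp add: phi_def)
  then show ?thesis
    using b m right_son_word_right_chain[of m]
    by (simp add: canopy_eq_butlast_right_son_word profile_def butlast_append)
qed

end
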